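(* Let $n\ge 2$ be an integer and let $0<a\le \sqrt{n}$. Let $m$ be the maximum number of vertices $\mathbf{v}\in\{-1,1\}^n$ of the $n$-dimensional standard cube that can be covered by an $n$-dimensional closed sphere (closed Euclidean ball in $\mathbb{R}^n$, with arbitrary center) of radius $r=\sqrt{n-a^2}$. Then $$2^{-\lceil a^2\rceil}\le 1-t_{n-1}^S(a)=\frac{m}{2^n}.$$ Moreover, for $a>\sqrt{n}$, $1-t_{n-1}^S(a)=0$.
   Context: Let $\varepsilon_1,\varepsilon_2,\ldots,\varepsilon_n$ be independent random variables with $P(\varepsilon_i=1)=P(\varepsilon_i=-1)=1/2$. Let $\mathcal{P}$ be the set of vectors $\mathbf{p}=(p_1,\ldots,p_n)\in\mathbb{R}^n$ of Euclidean norm 1, i.e. $\sum_{k=1}^n p_k^2=1$. For $a>0$ the quantity $t_{n-1}^S(a)$ is defined by $$1-t_{n-1}^S(a)=\sup_{\mathbf{p}\in\mathcal{P}}P\{p_1\varepsilon_1+p_2\varepsilon_2+\cdots+p_n\varepsilon_n\ge a\}.$$ $\lceil\cdot\rceil$ denotes the ceiling function. *)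

theory Defs
  imports "HOL-Probability.Probability"
begin

definition rademacher_family :: "'a measure \<Rightarrow> ('n::finite \<Rightarrow> 'a \<Rightarrow> real) \<Rightarrow> bool" where
  "rademacher_family M eps \<longleftrightarrow>
     prob_space.indep_vars M (\<lambda>_. borel) eps UNIV \<and>
     (\<forall>i. measure M {\<omega> \<in> space M. eps i \<omega> = 1} = 1/2 \<and>
          measure M {\<omega> \<in> space M. eps i \<omega> = -1} = 1/2)"

text \<open>The quantity t^S with subscript n - 1, where n = CARD('n).  It is stated relative to
  the probability space and the family it is computed from; only the joint law matters.\<close>

definition tS :: "'a measure \<Rightarrow> ('n::finite \<Rightarrow> 'a \<Rightarrow> real) \<Rightarrow> real \<Rightarrow> real" where
  "tS M eps a =
     1 - (SUP p \<in> {p :: real ^ 'n. norm p = 1}.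
            measure M {\<omega> \<in> space M. (\<Sum>i\<in>UNIV. p $ i * eps i \<omega>) \<ge> a})"

definition cube_vertices :: "(real ^ 'n) set" where
  "cube_vertices = {v. \<forall>i. v $ i \<in> {-1, 1}}"

end

theory Submission
  imports Defs
begin

text \<open>
  For a unit vector \<open>p\<close>, the event \<open>p\<^sub>1\<epsilon>\<^sub>1 + \<dots> + p\<^sub>n\<epsilon>\<^sub>n \<ge> a\<close> has probability \<open>N / 2 ^ n\<close>, where \<open>N\<close> counts
  the vertices of the cube in the half-space \<open>p \<bullet> v \<ge> a\<close>, because a Rademacher family is uniformly
  distributed on the vertices (\<open>rademacher_halfspace\<close>).

  All vertices lie on the sphere of radius \<open>sqrt n\<close> about the origin, and on that sphere half-spaces
  and balls cut out the same caps: the ball with centre \<open>a p\<close> and radius \<open>sqrt (n - a\<^sup>2)\<close> contains a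
  vertex exactly when the half-space \<open>p \<bullet> v \<ge> a\<close> does (\<open>vertices_in_halfspace_eq_ball\<close>). A ball of
  this radius around another centre \<open>c\<close> cuts out the half-space \<open>2 (v \<bullet> c) \<ge> a\<^sup>2 + norm c ^ 2\<close>, and
  since \<open>a\<^sup>2 + norm c ^ 2 \<ge> 2 a norm c\<close> this lies in the half-space belonging to the direction of
  \<open>c\<close> (\<open>vertices_in_ball_subset_halfspace\<close>). So the best half-space and the best ball cover equally
  many vertices.

  For the lower bound, put \<open>k = \<lceil>a\<^sup>2\<rceil>\<close> and spread the mass of \<open>p\<close> evenly over \<open>k\<close> coordinates. If
  the signs in these coordinates are all \<open>1\<close>, which has probability \<open>2 ^ -k\<close>, then the sum is
  \<open>sqrt k \<ge> a\<close>. If \<open>a > sqrt n\<close>, then no vertex lies in any of the half-spaces, by Cauchy-Schwarz.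
\<close>

section \<open>Vertices of the cube in half-spaces and balls\<close>

lemma finite_cube_vertices: "finite (cube_vertices :: (real ^ 'n::finite) set)"
proof -
  have "cube_vertices \<subseteq> vec_lambda ` (PiE (UNIV :: 'n set) (\<lambda>_. {-1, 1 :: real}))"
  proof
    fix v :: "real ^ 'n" assume "v \<in> cube_vertices"
    then have "vec_nth v \<in> PiE UNIV (\<lambda>_. {-1, 1})"
      by (auto simp: cube_vertices_def)
    then show "v \<in> vec_lambda ` (PiE UNIV (\<lambda>_. {-1, 1}))"
      by (metis image_eqI vec_nth_inverse)
  qed
  then show ?thesis
    by (rule finite_subset) (intro finite_imageI finite_PiE; simp)
qed

lemma inner_self_cube_vertex:
  fixes v :: "real ^ 'n::finite"
  assumes "v \<in> cube_vertices"
  shows "v \<bullet> v = real CARD('n)"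
proof -
  have "v $ i * v $ i = 1" for i
    using assms by (auto simp: cube_vertices_def dest!: spec[of _ i])
  then show ?thesis by (simp add: inner_vec_def)
qed

text \<open>As \<open>v \<bullet> v = n\<close> for every vertex, the quadratic condition \<open>norm (c - v) ^ 2 \<le> n - a\<^sup>2\<close> is
  linear in \<open>v\<close>.\<close>

lemma cube_vertex_in_ball_iff:
  fixes v c :: "real ^ 'n::finite"
  assumes "v \<in> cube_vertices"
  shows "v \<in> cball c (sqrt (real CARD('n) - a\<^sup>2)) \<longleftrightarrow> a\<^sup>2 + (norm c)\<^sup>2 \<le> 2 * (v \<bullet> c)"
proof -
  have "v \<in> cball c (sqrt (real CARD('n) - a\<^sup>2)) \<longleftrightarrow> (norm (c - v))\<^sup>2 \<le> real CARD('n) - a\<^sup>2"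
    by (auto simp: dist_norm intro: real_le_rsqrt dest!: sqrt_ge_absD[of "norm (c - v)", simplified])
  also have "(norm (c - v))\<^sup>2 = (norm c)\<^sup>2 + real CARD('n) - 2 * (v \<bullet> c)"
    using inner_self_cube_vertex[OF assms(1)]
    by (simp add: power2_norm_eq_inner inner_diff inner_commute)
  finally show ?thesis by auto
qed

text \<open>For \<open>norm p = 1\<close> the centre \<open>a p\<close> turns the linear condition into \<open>2 a\<^sup>2 \<le> 2 a (p \<bullet> v)\<close>;
  among all centres in the direction \<open>p\<close> it is the one for which \<open>a\<^sup>2 + norm c ^ 2 \<ge> 2 a norm c\<close>
  holds with equality.\<close>

lemma vertices_in_halfspace_eq_ball:
  fixes p :: "real ^ 'n::finite"
  assumes "norm p = 1" and "0 < a"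
  shows "{v \<in> cube_vertices. a \<le> p \<bullet> v}
       = cube_vertices \<inter> cball (a *\<^sub>R p) (sqrt (real CARD('n) - a\<^sup>2))"
proof -
  have "a\<^sup>2 + (norm (a *\<^sub>R p))\<^sup>2 \<le> 2 * (v \<bullet> (a *\<^sub>R p)) \<longleftrightarrow> a \<le> p \<bullet> v" for v
  proof -
    have "a\<^sup>2 + (norm (a *\<^sub>R p))\<^sup>2 \<le> 2 * (v \<bullet> (a *\<^sub>R p)) \<longleftrightarrow> a * a \<le> a * (p \<bullet> v)"
      using assms(1) by (simp add: power2_eq_square inner_commute)
    then show ?thesis using assms(2) by simp
  qed
  then show ?thesis
    using cube_vertex_in_ball_iff by blast
qed

text \<open>The centre \<open>0\<close> has no direction, but as \<open>a > 0\<close> the ball around it is too small to reach any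
  vertex, so every unit vector will do.\<close>

lemma vertices_in_ball_subset_halfspace:
  fixes c :: "real ^ 'n::finite"
  assumes "0 < a"
  obtains p :: "real ^ 'n" where "norm p = 1"
    and "cube_vertices \<inter> cball c (sqrt (real CARD('n) - a\<^sup>2)) \<subseteq> {v \<in> cube_vertices. a \<le> p \<bullet> v}"
proof (cases "c = 0")
  case True
  obtain p :: "real ^ 'n" where "norm p = 1"
    using vector_choose_size[of 1] by auto
  then show ?thesis
    using that cube_vertex_in_ball_iff[of _ c a] assms(1) True by fastforce
next
  case False
  have "a \<le> (c /\<^sub>R norm c) \<bullet> v"
    if v: "v \<in> cube_vertices" "v \<in> cball c (sqrt (real CARD('n) - a\<^sup>2))" for v
  proof -
    have "2 * (a * norm c) \<le> a\<^sup>2 + (norm c)\<^sup>2"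
      using sum_squares_bound[of a "norm c"] by simp
    also have "\<dots> \<le> 2 * (v \<bullet> c)"
      using cube_vertex_in_ball_iff[OF v(1)] v(2) by blast
    finally show ?thesis
      using False by (simp add: field_simps inner_commute)
  qed
  then have "cube_vertices \<inter> cball c (sqrt (real CARD('n) - a\<^sup>2))
      \<subseteq> {v \<in> cube_vertices. a \<le> (c /\<^sub>R norm c) \<bullet> v}"
    by blast
  moreover have "norm (c /\<^sub>R norm c) = 1"
    using False by simp
  ultimately show ?thesis by (rule that[rotated])
qed

lemma vertices_in_halfspace_empty:
  fixes p :: "real ^ 'n::finite"
  assumes "norm p = 1" and "sqrt (real CARD('n)) < a"
  shows "{v \<in> cube_vertices. a \<le> p \<bullet> v} = {}"
proof -
  have "p \<bullet> v < a" if "v \<in> cube_vertices" for v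
    using norm_cauchy_schwarz[of p v] inner_self_cube_vertex[OF that] assms
    by (simp add: norm_eq_sqrt_inner)
  then show ?thesis by force
qed

section \<open>Rademacher families\<close>

text \<open>Partial patterns are allowed because two cases are needed: \<open>S = UNIV\<close> describes single
  vertices, and a smaller \<open>S\<close> describes a face of the cube, for the lower bound.\<close>

lemma rademacher_prob_pattern:
  fixes eps :: "'n::finite \<Rightarrow> 'a \<Rightarrow> real" and v :: "'n \<Rightarrow> real"
  assumes "prob_space M" and "rademacher_family M eps" and "\<And>i. i \<in> S \<Longrightarrow> v i \<in> {-1, 1}"
  shows "measure M {\<omega> \<in> space M. \<forall>i\<in>S. eps i \<omega> = v i} = (1/2) ^ card S"
proof -
  interpret prob_space M by fact
  show ?thesis
  proof (cases "S = {}")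
    case True
    then show ?thesis by (simp add: prob_space)
  next
    case False
    have "indep_vars (\<lambda>_. borel) eps UNIV"
      using assms(2) by (simp add: rademacher_family_def)
    then have "prob (\<Inter>i\<in>S. eps i -` {v i} \<inter> space M) = (\<Prod>i\<in>S. prob (eps i -` {v i} \<inter> space M))"
      by (rule indep_varsD) (use False in auto)
    also have "\<dots> = (\<Prod>i\<in>S. 1/2)"
    proof (rule prod.cong)
      fix i assume "i \<in> S"
      have "eps i -` {v i} \<inter> space M = {\<omega> \<in> space M. eps i \<omega> = v i}" by auto
      then show "prob (eps i -` {v i} \<inter> space M) = 1/2"
        using assms(2) assms(3)[OF \<open>i \<in> S\<close>] by (auto simp: rademacher_family_def)
    qed simp
    also have "(\<Inter>i\<in>S. eps i -` {v i} \<inter> space M) = {\<omega> \<in> space M. \<forall>i\<in>S. eps i \<omega> = v i}"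
      using False by auto
    finally show ?thesis by simp
  qed
qed

lemma rademacher_measurable:
  assumes "prob_space M" and "rademacher_family M eps"
  shows "eps i \<in> borel_measurable M"
  using assms by (auto simp: rademacher_family_def prob_space.indep_vars_def2)

lemma rademacher_AE_sign:
  assumes "prob_space M" and "rademacher_family M eps"
  shows "AE \<omega> in M. eps i \<omega> \<in> {-1, 1}"
proof -
  interpret prob_space M by fact
  note [measurable] = rademacher_measurable[OF assms]
  have "prob {\<omega> \<in> space M. eps i \<omega> = -1 \<or> eps i \<omega> = 1}
      = prob ({\<omega> \<in> space M. eps i \<omega> = -1} \<union> {\<omega> \<in> space M. eps i \<omega> = 1})"
    by (rule arg_cong[where f = prob]) auto
  also have "\<dots> = prob {\<omega> \<in> space M. eps i \<omega> = -1} + prob {\<omega> \<in> space M. eps i \<omega> = 1}"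
    by (rule finite_measure_Union) auto
  also have "\<dots> = 1"
    using assms(2) unfolding rademacher_family_def by (metis field_sum_of_halves)
  finally have "prob {\<omega> \<in> space M. eps i \<omega> = -1 \<or> eps i \<omega> = 1} = 1" .
  then show ?thesis
    by (subst (asm) prob_Collect_eq_1) auto
qed

text \<open>Up to a null set, the event is the disjoint union, over the vertices in the half-space, of
  the events that the family takes exactly this sign pattern.\<close>

lemma rademacher_halfspace:
  fixes eps :: "'n::finite \<Rightarrow> 'a \<Rightarrow> real" and p :: "real ^ 'n"
  assumes "prob_space M" and "rademacher_family M eps"
  shows "measure M {\<omega> \<in> space M. (\<Sum>i\<in>UNIV. p $ i * eps i \<omega>) \<ge> a}
       = real (card {v \<in> cube_vertices. a \<le> p \<bullet> v}) / 2 ^ CARD('n)"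
proof -
  interpret prob_space M by fact
  note [measurable] = rademacher_measurable[OF assms]
  define V where "V = {v \<in> cube_vertices. a \<le> p \<bullet> v}"
  define A where "A v = {\<omega> \<in> space M. \<forall>i\<in>UNIV. eps i \<omega> = v $ i}" for v :: "real ^ 'n"
  have [measurable]: "A v \<in> sets M" for v
    unfolding A_def by measurable
  have finV: "finite V"
    unfolding V_def using finite_cube_vertices by (rule finite_subset[rotated]) auto
  have "AE \<omega> in M. \<forall>i. eps i \<omega> \<in> {-1, 1}"
    using rademacher_AE_sign[OF assms] by (subst AE_all_countable) blast
  then have "AE \<omega> in M. \<omega> \<in> {\<omega> \<in> space M. (\<Sum>i\<in>UNIV. p $ i * eps i \<omega>) \<ge> a} \<longleftrightarrow> \<omega> \<in> (\<Union>v\<in>V. A v)"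
  proof (rule AE_mp, intro AE_I2 impI)
    fix \<omega> assume \<omega>: "\<omega> \<in> space M" "\<forall>i. eps i \<omega> \<in> {-1, 1}"
    have "\<omega> \<in> A v \<longleftrightarrow> v = (\<chi> i. eps i \<omega>)" for v
      using \<omega>(1) by (auto simp: A_def vec_eq_iff)
    moreover have "(\<chi> i. eps i \<omega>) \<in> cube_vertices"
      using \<omega>(2) by (simp add: cube_vertices_def)
    ultimately show "\<omega> \<in> {\<omega> \<in> space M. (\<Sum>i\<in>UNIV. p $ i * eps i \<omega>) \<ge> a} \<longleftrightarrow> \<omega> \<in> (\<Union>v\<in>V. A v)"
      using \<omega>(1) by (auto simp: V_def inner_vec_def)
  qed
  then have "prob {\<omega> \<in> space M. (\<Sum>i\<in>UNIV. p $ i * eps i \<omega>) \<ge> a} = prob (\<Union>v\<in>V. A v)"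
    using finV by (intro finite_measure_eq_AE) (auto intro!: sets.finite_UN)
  also have "\<dots> = (\<Sum>v\<in>V. prob (A v))"
    using finV by (intro finite_measure_finite_Union)
      (auto simp: disjoint_family_on_def A_def vec_eq_iff)
  also have "\<dots> = (\<Sum>v\<in>V. (1/2) ^ CARD('n))"
    unfolding A_def
    by (intro sum.cong refl rademacher_prob_pattern[OF assms])
       (auto simp: V_def cube_vertices_def)
  also have "\<dots> = real (card V) / 2 ^ CARD('n)"
    by (simp add: power_one_over)
  finally show ?thesis by (simp add: V_def)
qed

section \<open>The supremum over unit vectors\<close>

lemma one_minus_tS:
  fixes eps :: "'n::finite \<Rightarrow> 'a \<Rightarrow> real"
  shows "1 - tS M eps a = (SUP p \<in> {p :: real ^ 'n. norm p = 1}.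
            measure M {\<omega> \<in> space M. (\<Sum>i\<in>UNIV. p $ i * eps i \<omega>) \<ge> a})"
  by (simp add: tS_def)

lemma prob_le_one_minus_tS:
  fixes eps :: "'n::finite \<Rightarrow> 'a \<Rightarrow> real" and p :: "real ^ 'n"
  assumes "prob_space M" and "norm p = 1"
  shows "measure M {\<omega> \<in> space M. (\<Sum>i\<in>UNIV. p $ i * eps i \<omega>) \<ge> a} \<le> 1 - tS M eps a"
  unfolding one_minus_tS
  by (rule cSUP_upper)
     (use assms in \<open>auto intro!: bdd_aboveI[of _ 1] prob_space.prob_le_1\<close>)

lemma one_minus_tS_le:
  fixes eps :: "'n::finite \<Rightarrow> 'a \<Rightarrow> real"
  assumes "\<And>p :: real ^ 'n. norm p = 1 \<Longrightarrow>
    measure M {\<omega> \<in> space M. (\<Sum>i\<in>UNIV. p $ i * eps i \<omega>) \<ge> a} \<le> b"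
  shows "1 - tS M eps a \<le> b"
proof -
  obtain p :: "real ^ 'n" where "norm p = 1"
    using vector_choose_size[of 1] by auto
  then show ?thesis
    unfolding one_minus_tS by (intro cSUP_least) (use assms in auto)
qed

text \<open>Each half-space is matched by a ball covering the same vertices, and each ball by a half-space
  covering at least as many; a best ball exists because the counts are bounded by the number of
  vertices.\<close>

lemma one_minus_tS_eq_max_cover:
  fixes eps :: "'n::finite \<Rightarrow> 'a \<Rightarrow> real"
  assumes "prob_space M" and "rademacher_family M eps" and "0 < a"
  shows "1 - tS M eps a = real (Max (range (\<lambda>c :: real ^ 'n.
           card (cube_vertices \<inter> cball c (sqrt (real CARD('n) - a\<^sup>2)))))) / 2 ^ CARD('n)"
proof -
  define N where "N c = card (cube_vertices \<inter> cball c (sqrt (real CARD('n) - a\<^sup>2)))" for c :: "real ^ 'n"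
  have "N c \<le> card (cube_vertices :: (real ^ 'n) set)" for c
    unfolding N_def by (intro card_mono finite_cube_vertices) auto
  then have fin: "finite (range N)"
    by (intro finite_subset[of "range N" "{..card (cube_vertices :: (real ^ 'n) set)}"]) auto
  have "1 - tS M eps a \<le> real (Max (range N)) / 2 ^ CARD('n)"
  proof (rule one_minus_tS_le)
    fix p :: "real ^ 'n" assume p: "norm p = 1"
    have "N (a *\<^sub>R p) \<le> Max (range N)"
      using fin by (intro Max_ge) auto
    then show "measure M {\<omega> \<in> space M. (\<Sum>i\<in>UNIV. p $ i * eps i \<omega>) \<ge> a}
        \<le> real (Max (range N)) / 2 ^ CARD('n)"
      by (simp add: rademacher_halfspace[OF assms(1,2)] vertices_in_halfspace_eq_ball[OF p assms(3)]
          N_def divide_right_mono)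
  qed
  moreover have "real (Max (range N)) / 2 ^ CARD('n) \<le> 1 - tS M eps a"
  proof -
    obtain c where c: "Max (range N) = N c"
      using Max_in[OF fin] by auto
    obtain p :: "real ^ 'n" where p: "norm p = 1"
      "cube_vertices \<inter> cball c (sqrt (real CARD('n) - a\<^sup>2)) \<subseteq> {v \<in> cube_vertices. a \<le> p \<bullet> v}"
      using vertices_in_ball_subset_halfspace[OF assms(3)] .
    have "N c \<le> card {v \<in> cube_vertices. a \<le> p \<bullet> v}"
      unfolding N_def using p(2) finite_cube_vertices by (intro card_mono) auto
    then have "real (N c) / 2 ^ CARD('n)
        \<le> measure M {\<omega> \<in> space M. (\<Sum>i\<in>UNIV. p $ i * eps i \<omega>) \<ge> a}"
      by (simp add: rademacher_halfspace[OF assms(1,2)] divide_right_mono)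
    also have "\<dots> \<le> 1 - tS M eps a"
      using assms(1) p(1) by (rule prob_le_one_minus_tS)
    finally show ?thesis by (simp add: c)
  qed
  ultimately show ?thesis
    unfolding N_def by (rule antisym)
qed

text \<open>The unit vector with equal entries on \<open>k\<close> coordinates gives the value \<open>k / sqrt k = sqrt k\<close> on
  the whole face of the cube where these \<open>k\<close> signs are \<open>1\<close>.\<close>

lemma one_minus_tS_ge:
  fixes eps :: "'n::finite \<Rightarrow> 'a \<Rightarrow> real"
  assumes "prob_space M" and "rademacher_family M eps"
    and "0 < k" and "k \<le> CARD('n)" and "a \<le> sqrt (real k)"
  shows "(1/2) ^ k \<le> 1 - tS M eps a"
proof -
  interpret prob_space M by fact
  note [measurable] = rademacher_measurable[OF assms(1,2)]
  obtain S :: "'n set" where S: "card S = k"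
    using assms(4) by (metis obtain_subset_with_card_n)
  define p :: "real ^ 'n" where "p = (\<chi> i. if i \<in> S then 1 / sqrt (real k) else 0)"
  have "p \<bullet> p = (\<Sum>i\<in>UNIV. if i \<in> S then 1 / real k else 0)"
    by (simp add: p_def inner_vec_def if_distrib cong: if_cong)
  also have "\<dots> = 1"
    using assms(3) S by (simp add: sum.If_cases)
  finally have p: "norm p = 1"
    by (simp add: norm_eq_sqrt_inner)
  have "(\<Sum>i\<in>UNIV. p $ i * eps i \<omega>) \<ge> a" if "\<forall>i\<in>S. eps i \<omega> = 1" for \<omega>
  proof -
    have "(\<Sum>i\<in>UNIV. p $ i * eps i \<omega>) = (\<Sum>i\<in>UNIV. if i \<in> S then 1 / sqrt (real k) else 0)"
      using that by (intro sum.cong) (auto simp: p_def)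
    also have "\<dots> = sqrt (real k)"
      using S by (simp add: sum.If_cases real_div_sqrt)
    finally show ?thesis using assms(5) by simp
  qed
  then have "prob {\<omega> \<in> space M. \<forall>i\<in>S. eps i \<omega> = 1}
      \<le> prob {\<omega> \<in> space M. (\<Sum>i\<in>UNIV. p $ i * eps i \<omega>) \<ge> a}"
    by (intro finite_measure_mono) auto
  also have "\<dots> \<le> 1 - tS M eps a"
    using assms(1) p by (rule prob_le_one_minus_tS)
  finally show ?thesis
    using rademacher_prob_pattern[OF assms(1,2), of S "\<lambda>_. 1"] S by simp
qed

theorem theorem2p1:
  fixes M :: "'a measure"
    and eps :: "'n::finite \<Rightarrow> 'a \<Rightarrow> real"
    and a :: real
  assumes "prob_space M"
    and "rademacher_family M eps"
    and "CARD('n) \<ge> 2"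
  shows "(0 < a \<and> a \<le> sqrt (real CARD('n)) \<longrightarrow>
           (let r = sqrt (real CARD('n) - a\<^sup>2);
                m = Max (range (\<lambda>c :: real ^ 'n. card (cube_vertices \<inter> cball c r)))
            in 2 powi (- \<lceil>a\<^sup>2\<rceil>) \<le> 1 - tS M eps a \<and>
               1 - tS M eps a = real m / 2 ^ CARD('n)))
       \<and> (a > sqrt (real CARD('n)) \<longrightarrow> 1 - tS M eps a = 0)"
proof (intro conjI impI)
  assume a: "0 < a \<and> a \<le> sqrt (real CARD('n))"
  then have a2: "a\<^sup>2 \<le> real CARD('n)"
    by (simp add: sqrt_ge_absD)
  define k where "k = nat \<lceil>a\<^sup>2\<rceil>"
  have "0 < a\<^sup>2"
    using a by simp
  then have "0 < \<lceil>a\<^sup>2\<rceil>"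
    by (simp only: zero_less_ceiling)
  then have k: "\<lceil>a\<^sup>2\<rceil> = int k" "0 < k"
    unfolding k_def by (simp_all only: zero_less_nat_eq nat_0_le less_imp_le)
  have "k \<le> CARD('n)"
    using a2 by (simp add: k_def ceiling_le_iff nat_le_iff)
  moreover have "a \<le> sqrt (real k)"
    using k(1) by (intro real_le_rsqrt) (metis le_of_int_ceiling of_int_of_nat_eq)
  ultimately have "(1/2) ^ k \<le> 1 - tS M eps a"
    using one_minus_tS_ge[OF assms(1,2) k(2)] by blast
  moreover have "2 powi (- \<lceil>a\<^sup>2\<rceil>) = (1/2 :: real) ^ k"
    by (simp add: k(1) power_int_minus power_one_over inverse_eq_divide)
  ultimately show "let r = sqrt (real CARD('n) - a\<^sup>2);
                m = Max (range (\<lambda>c :: real ^ 'n. card (cube_vertices \<inter> cball c r)))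
            in 2 powi (- \<lceil>a\<^sup>2\<rceil>) \<le> 1 - tS M eps a \<and>
               1 - tS M eps a = real m / 2 ^ CARD('n)"
    using one_minus_tS_eq_max_cover[OF assms(1,2)] a by (simp add: Let_def)
next
  assume a: "a > sqrt (real CARD('n))"
  have zero: "measure M {\<omega> \<in> space M. (\<Sum>i\<in>UNIV. p $ i * eps i \<omega>) \<ge> a} = 0"
    if "norm p = 1" for p :: "real ^ 'n"
    by (simp add: rademacher_halfspace[OF assms(1,2)] vertices_in_halfspace_empty[OF that a])
  obtain p :: "real ^ 'n" where "norm p = 1"
    using vector_choose_size[of 1] by auto
  then show "1 - tS M eps a = 0"
    using zero prob_le_one_minus_tS[OF assms(1), of p a eps]
    by (intro antisym one_minus_tS_le) auto
qed

end
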